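(* Let $n\ge 2$. On the semigroup $\mathcal{SS}'_n$, Green's relations satisfy $\mathcal{H}=\mathcal{R}$.
   Context: Let $[n]=\{1,2,\dots,n\}$ with its usual order. $\mathcal{P}_n$ is the semigroup of all partial transformations of $[n]$ (maps whose domain and image are subsets of $[n]$, including the empty map), composed from left to right: $x(\alpha\beta)=(x\alpha)\beta$. A partial map $\alpha$ is isotone if $x\le y$ implies $x\alpha\le y\alpha$ for all $x,y\in\mathrm{Dom}\,\alpha$, and order-decreasing if $x\alpha\le x$ for all $x\in\mathrm{Dom}\,\alpha$. $\mathcal{LS}_n$ is the monoid of all isotone order-decreasing $\alpha\in\mathcal{P}_n$, and $\mathcal{SS}'_n=\{\alpha\in\mathcal{LS}_n: 1\notin \mathrm{Dom}\,\alpha\}$, a subsemigroup of $\mathcal{LS}_n$. For a semigroup $S$, $S^1$ is $S$ with an identity adjoined if necessary; $a\,\mathcal{L}\,b$ iff $S^1a=S^1b$, $a\,\mathcal{R}\,b$ iff $aS^1=bS^1$, and $\mathcal{H}=\mathcal{L}\cap\mathcal{R}$. *)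

theory Defs
  imports Main
begin

text \<open>Semigroups are given by a carrier \<open>S\<close> and a multiplication \<open>m\<close>. In \<open>adjoin_one S m\<close> the
  elements of \<open>S\<close> appear as \<open>Some s\<close>, and \<open>None\<close> is the adjoined identity, present only when \<open>S\<close>
  has no identity of its own.\<close>

definition adjoin_one :: "'a set \<Rightarrow> ('a \<Rightarrow> 'a \<Rightarrow> 'a) \<Rightarrow> 'a option set" where
  "adjoin_one S m =
     (if \<exists>e\<in>S. \<forall>x\<in>S. m e x = x \<and> m x e = x then Some ` S else insert None (Some ` S))"

fun adjoin_one_mult :: "('a \<Rightarrow> 'a \<Rightarrow> 'a) \<Rightarrow> 'a option \<Rightarrow> 'a option \<Rightarrow> 'a option" where
  "adjoin_one_mult m (Some a) (Some b) = Some (m a b)"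
| "adjoin_one_mult m None y = y"
| "adjoin_one_mult m x None = x"

definition principal_left_ideal :: "'a set \<Rightarrow> ('a \<Rightarrow> 'a \<Rightarrow> 'a) \<Rightarrow> 'a \<Rightarrow> 'a option set" where
  "principal_left_ideal S m a = (\<lambda>s. adjoin_one_mult m s (Some a)) ` adjoin_one S m"

definition principal_right_ideal :: "'a set \<Rightarrow> ('a \<Rightarrow> 'a \<Rightarrow> 'a) \<Rightarrow> 'a \<Rightarrow> 'a option set" where
  "principal_right_ideal S m a = (\<lambda>s. adjoin_one_mult m (Some a) s) ` adjoin_one S m"

definition green_L :: "'a set \<Rightarrow> ('a \<Rightarrow> 'a \<Rightarrow> 'a) \<Rightarrow> 'a rel" where
  "green_L S m =
     {(a, b). a \<in> S \<and> b \<in> S \<and> principal_left_ideal S m a = principal_left_ideal S m b}"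

definition green_R :: "'a set \<Rightarrow> ('a \<Rightarrow> 'a \<Rightarrow> 'a) \<Rightarrow> 'a rel" where
  "green_R S m =
     {(a, b). a \<in> S \<and> b \<in> S \<and> principal_right_ideal S m a = principal_right_ideal S m b}"

definition green_H :: "'a set \<Rightarrow> ('a \<Rightarrow> 'a \<Rightarrow> 'a) \<Rightarrow> 'a rel" where
  "green_H S m = green_L S m \<inter> green_R S m"

definition partial_transformations :: "nat \<Rightarrow> (nat \<rightharpoonup> nat) set" where
  "partial_transformations n = {\<alpha>. dom \<alpha> \<subseteq> {1..n} \<and> ran \<alpha> \<subseteq> {1..n}}"

text \<open>Left-to-right composition, \<open>x (\<alpha>\<beta>) = (x \<alpha>) \<beta>\<close>, hence the swapped arguments.\<close>

definition pcomp :: "(nat \<rightharpoonup> nat) \<Rightarrow> (nat \<rightharpoonup> nat) \<Rightarrow> (nat \<rightharpoonup> nat)" where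
  "pcomp \<alpha> \<beta> = \<beta> \<circ>\<^sub>m \<alpha>"

definition isotone :: "(nat \<rightharpoonup> nat) \<Rightarrow> bool" where
  "isotone \<alpha> \<longleftrightarrow> (\<forall>x\<in>dom \<alpha>. \<forall>y\<in>dom \<alpha>. x \<le> y \<longrightarrow> the (\<alpha> x) \<le> the (\<alpha> y))"

definition order_decreasing :: "(nat \<rightharpoonup> nat) \<Rightarrow> bool" where
  "order_decreasing \<alpha> \<longleftrightarrow> (\<forall>x\<in>dom \<alpha>. the (\<alpha> x) \<le> x)"

definition LS :: "nat \<Rightarrow> (nat \<rightharpoonup> nat) set" where
  "LS n = {\<alpha> \<in> partial_transformations n. isotone \<alpha> \<and> order_decreasing \<alpha>}"

definition SS' :: "nat \<Rightarrow> (nat \<rightharpoonup> nat) set" where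
  "SS' n = {\<alpha> \<in> LS n. 1 \<notin> dom \<alpha>}"

lemma pcomp_apply: "pcomp \<alpha> \<beta> x = Option.bind (\<alpha> x) \<beta>"
  by (simp add: pcomp_def map_comp_def split: option.split)

lemma pcomp_assoc: "pcomp (pcomp \<alpha> \<beta>) \<gamma> = pcomp \<alpha> (pcomp \<beta> \<gamma>)"
  by (simp add: pcomp_def fun_eq_iff map_comp_def split: option.split)

lemma LS_iff:
  "\<alpha> \<in> LS n \<longleftrightarrow>
     (\<forall>x y. \<alpha> x = Some y \<longrightarrow> x \<in> {1..n} \<and> y \<in> {1..n} \<and> y \<le> x) \<and>
     (\<forall>x y u v. \<alpha> x = Some u \<longrightarrow> \<alpha> y = Some v \<longrightarrow> x \<le> y \<longrightarrow> u \<le> v)"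
proof -
  have "isotone \<alpha> \<longleftrightarrow> (\<forall>x y u v. \<alpha> x = Some u \<longrightarrow> \<alpha> y = Some v \<longrightarrow> x \<le> y \<longrightarrow> u \<le> v)"
    unfolding isotone_def dom_def by force
  moreover have "order_decreasing \<alpha> \<longleftrightarrow> (\<forall>x y. \<alpha> x = Some y \<longrightarrow> y \<le> x)"
    unfolding order_decreasing_def dom_def by force
  moreover have "\<alpha> \<in> partial_transformations n \<longleftrightarrow>
      (\<forall>x y. \<alpha> x = Some y \<longrightarrow> x \<in> {1..n} \<and> y \<in> {1..n})"
    unfolding partial_transformations_def dom_def ran_def by blast
  ultimately show ?thesis
    unfolding LS_def by blast
qed

lemma pcomp_in_LS:
  assumes "\<alpha> \<in> LS n" "\<beta> \<in> LS n"
  shows "pcomp \<alpha> \<beta> \<in> LS n"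
proof -
  have c: "\<exists>y. \<alpha> x = Some y \<and> \<beta> y = Some z" if "pcomp \<alpha> \<beta> x = Some z" for x z
    using that by (simp add: pcomp_apply bind_eq_Some_conv)
  have a: "x \<in> {1..n} \<and> y \<in> {1..n} \<and> y \<le> x" if "\<alpha> x = Some y" for x y
    using assms(1) that unfolding LS_iff by blast
  have b: "x \<in> {1..n} \<and> y \<in> {1..n} \<and> y \<le> x" if "\<beta> x = Some y" for x y
    using assms(2) that unfolding LS_iff by blast
  have am: "u \<le> v" if "\<alpha> x = Some u" "\<alpha> y = Some v" "x \<le> y" for x y u v
    using assms(1) that unfolding LS_iff by blast
  have bm: "u \<le> v" if "\<beta> x = Some u" "\<beta> y = Some v" "x \<le> y" for x y u v
    using assms(2) that unfolding LS_iff by blast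
  show ?thesis
    unfolding LS_iff
  proof (intro conjI allI impI)
    fix x z assume "pcomp \<alpha> \<beta> x = Some z"
    then obtain y where y: "\<alpha> x = Some y" "\<beta> y = Some z" using c by blast
    show "x \<in> {1..n}" using a[OF y(1)] by blast
    show "z \<in> {1..n}" using b[OF y(2)] by blast
    show "z \<le> x" using a[OF y(1)] b[OF y(2)] by simp
  next
    fix x y u v assume "pcomp \<alpha> \<beta> x = Some u" "pcomp \<alpha> \<beta> y = Some v" and le: "x \<le> y"
    then obtain p q where p: "\<alpha> x = Some p" "\<beta> p = Some u" and q: "\<alpha> y = Some q" "\<beta> q = Some v"
      using c by blast
    show "u \<le> v" by (rule bm[OF p(2) q(2) am[OF p(1) q(1) le]])
  qed
qed

lemma pcomp_in_SS':
  assumes "\<alpha> \<in> SS' n" "\<beta> \<in> SS' n"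
  shows "pcomp \<alpha> \<beta> \<in> SS' n"
  using assms pcomp_in_LS[of \<alpha> n \<beta>] by (auto simp: SS'_def pcomp_apply domIff)

end

theory Submission
  imports Defs
begin

text \<open>Right multiplication by an order-decreasing map can only shrink the graph's domain and lower
  its values, so two \<open>\<R>\<close>-related elements bound each other pointwise. Hence \<open>\<R>\<close> is the identity
  relation, which is contained in \<open>\<L>\<close>.\<close>

text \<open>\<open>adjoin_one\<close> contains \<open>None\<close> only when \<open>S\<close> has no
  identity, so the multiplier fixing \<open>a\<close> is the identity of \<open>S\<close> if there
  is one and \<open>None\<close> otherwise.\<close>

lemma self_in_principal_right_ideal:
  assumes "a \<in> S"
  shows "Some a \<in> principal_right_ideal S m a"
proof (cases "\<exists>e\<in>S. \<forall>x\<in>S. m e x = x \<and> m x e = x")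
  case True
  then obtain e where "e \<in> S" "m a e = a"
    using assms by blast
  then have "Some e \<in> adjoin_one S m" "Some a = adjoin_one_mult m (Some a) (Some e)"
    unfolding adjoin_one_def by auto
  then show ?thesis
    unfolding principal_right_ideal_def by blast
next
  case False
  then have "None \<in> adjoin_one S m" "Some a = adjoin_one_mult m (Some a) None"
    unfolding adjoin_one_def by auto
  then show ?thesis
    unfolding principal_right_ideal_def by blast
qed

text \<open>The alternative \<open>b = a\<close> accounts for the multiplier \<open>None\<close>,
  the other one for \<open>Some s\<close>.\<close>

lemma principal_right_ideal_cases:
  assumes "Some b \<in> principal_right_ideal S m a"
  obtains "b = a" | s where "s \<in> S" "b = m a s"
  using assms unfolding principal_right_ideal_def adjoin_one_def
  by (auto split: if_splits)

lemma principal_right_ideal_SS'_decreasing: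
  assumes "Some \<beta> \<in> principal_right_ideal (SS' n) pcomp \<alpha>" and "\<beta> x = Some v"
  shows "\<exists>u. \<alpha> x = Some u \<and> v \<le> u"
  using assms(1)
proof (cases rule: principal_right_ideal_cases)
  case 1
  then show ?thesis using assms(2) by simp
next
  case (2 \<gamma>)
  then obtain u where "\<alpha> x = Some u" "\<gamma> u = Some v"
    using assms(2) by (auto simp: pcomp_apply bind_eq_Some_conv)
  moreover have "v \<le> u"
    using \<open>\<gamma> \<in> SS' n\<close> \<open>\<gamma> u = Some v\<close> unfolding SS'_def LS_iff by blast
  ultimately show ?thesis by blast
qed

lemma green_R_SS': "green_R (SS' n) pcomp = Id_on (SS' n)"
proof -
  have "\<alpha> = \<beta>" if "(\<alpha>, \<beta>) \<in> green_R (SS' n) pcomp" for \<alpha> \<beta>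
  proof -
    \<comment> \<open>Each map lies in its own ideal, and the two ideals coincide.\<close>
    have "Some \<beta> \<in> principal_right_ideal (SS' n) pcomp \<alpha>"
      and "Some \<alpha> \<in> principal_right_ideal (SS' n) pcomp \<beta>"
      using that self_in_principal_right_ideal[of _ "SS' n" pcomp]
      unfolding green_R_def by auto
    note le = this[THEN principal_right_ideal_SS'_decreasing]
    show ?thesis
    proof (rule map_le_antisym; unfold map_le_def; intro ballI)
      \<comment> \<open>\<open>le(2)\<close> puts \<open>x\<close> into the domain of \<beta> with
        \<alpha> x \<le> \<beta> x; \<open>le(1)\<close> then gives the reverse inequality.\<close>
      show "\<alpha> x = \<beta> x" if "x \<in> dom \<alpha>" for x
        using that le(1)[of x] le(2)[of x] by fastforce
      show "\<beta> x = \<alpha> x" if "x \<in> dom \<beta>" for x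
        using that le(1)[of x] le(2)[of x] by fastforce
    qed
  qed
  then show ?thesis
    unfolding green_R_def by auto
qed

theorem corollary2p3:
  fixes n :: nat
  assumes "n \<ge> 2"
  shows "green_H (SS' n) pcomp = green_R (SS' n) pcomp"
  \<comment> \<open>Intersecting with \<L> removes nothing from the identity relation, as \<L> is
    reflexive on \<open>SS' n\<close>.\<close>
  unfolding green_H_def green_R_SS' by (auto simp: green_L_def)

end
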